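(* Let $(\mathfrak{g},B)$ be a non-abelian quadratic Lie superalgebra of dimension $4$ over $\mathbb{C}$. (i) If $\dim\mathfrak{g}_{\bar 1}=0$, then $(\mathfrak g,B)$ is not quadratic symplectic; that is, there is no non-abelian quadratic symplectic Lie superalgebra of dimension $4$ with zero odd part. (ii) If $\dim\mathfrak{g}_{\bar 0}=\dim\mathfrak{g}_{\bar 1}=2$, then there exists, up to i-isomorphism, exactly one such quadratic Lie superalgebra that is quadratic symplectic, namely $\mathfrak{g}_{4,1}^s=\mathfrak{g}_{\bar 0}\oplus\mathfrak{g}_{\bar 1}$ with $\mathfrak{g}_{\bar 0}=\mathrm{span}_{\mathbb{C}}\{X_0,X_1\}$, $\mathfrak{g}_{\bar 1}=\mathrm{span}_{\mathbb{C}}\{Y_1,Y_2\}$, invariant scalar product given by $B(X_0,X_1)=B(Y_2,Y_1)=1$ and non-trivial brackets $$[X_1,Y_1]=-[Y_1,X_1]=-2Y_2,\qquad [Y_1,Y_1]=-2X_0.$$ Moreover, any symplectic structure $\omega$ on $\mathfrak{g}_{4,1}^s$ is given by $$\omega(X_0,X_1)=2b_1,\qquad \omega(Y_2,Y_1)=-b_1,\qquad \omega(Y_1,Y_1)=b_2,$$ where $b_1,b_2\in\mathbb{C}$ are parameters with $b_1\neq 0$.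
   Context: A Lie superalgebra is a $\mathbb{Z}_2$-graded vector space $\mathfrak{g}=\mathfrak{g}_{\bar 0}\oplus\mathfrak{g}_{\bar 1}$ with an even bilinear bracket satisfying, for homogeneous $X,Y,Z$ of degrees $x,y,z$, $[X,Y]=-(-1)^{xy}[Y,X]$ and $(-1)^{xz}[X,[Y,Z]]+(-1)^{xy}[Y,[Z,X]]+(-1)^{yz}[Z,[X,Y]]=0$. A bilinear form $F$ on $\mathfrak{g}$ is even if $F(\mathfrak{g}_{\bar 0},\mathfrak{g}_{\bar 1})=F(\mathfrak{g}_{\bar 1},\mathfrak{g}_{\bar 0})=\{0\}$. $(\mathfrak{g},B)$ is quadratic if $B$ is an invariant scalar product, i.e. an even, non-degenerate bilinear form that is supersymmetric ($B(X,Y)=(-1)^{xy}B(Y,X)$) and invariant ($B([X,Y],Z)=B(X,[Y,Z])$). A symplectic structure is an even, non-degenerate bilinear form $\omega$ that is skew-supersymmetric ($\omega(X,Y)=-(-1)^{xy}\omega(Y,X)$) and a scalar $2$-cocycle ($(-1)^{xz}\omega(X,[Y,Z])+(-1)^{yx}\omega(Y,[Z,X])+(-1)^{zy}\omega(Z,[X,Y])=0$). A quadratic symplectic Lie superalgebra is one equipped with both. Two quadratic Lie superalgebras $(\mathfrak{g},B)$, $(\mathfrak{g}',B')$ are i-isomorphic if there is a Lie superalgebra isomorphism $A:\mathfrak{g}\to\mathfrak{g}'$ with $B'(A(X),A(Y))=B(X,Y)$ for all $X,Y$. Values of $B$ or $\omega$ on pairs of basis vectors not listed and not determined from the listed ones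 by (skew-)supersymmetry are zero. *)

theory Defs
  imports "HOL-Analysis.Cartesian_Space" "HOL-Library.Z2"
begin

text \<open>
  Complex vector spaces are whole types with an explicit scalar multiplication (locale
  \<^locale>\<open>vector_space\<close>). Degrees are elements of the two-element field \<^typ>\<open>bit\<close>, so that
  \<^term>\<open>x + y\<close> is the degree of a bracket of elements of degrees \<^term>\<open>x\<close> and \<^term>\<open>y\<close>.
\<close>

text \<open>The sign $(-1)^{xy}$.\<close>

definition koszul_sign :: "bit \<Rightarrow> bit \<Rightarrow> complex"
  where "koszul_sign x y = (if x * y = 1 then - 1 else 1)"

definition bilinear_map ::
    "(complex \<Rightarrow> 'a::ab_group_add \<Rightarrow> 'a) \<Rightarrow> (complex \<Rightarrow> 'b::ab_group_add \<Rightarrow> 'b)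
      \<Rightarrow> ('a \<Rightarrow> 'a \<Rightarrow> 'b) \<Rightarrow> bool"
  where "bilinear_map s t F \<longleftrightarrow>
    (\<forall>u. Vector_Spaces.linear s t (\<lambda>v. F u v)) \<and> (\<forall>v. Vector_Spaces.linear s t (\<lambda>u. F u v))"

locale super_vector_space = vector_space scale
  for scale :: "complex \<Rightarrow> 'a::ab_group_add \<Rightarrow> 'a" +
  fixes V :: "bit \<Rightarrow> 'a set"
  assumes subspace_V: "subspace (V d)"
    and V_sum: "\<exists>u\<in>V 0. \<exists>v\<in>V 1. w = u + v"
    and V_direct: "V 0 \<inter> V 1 = {0}"
begin

definition even_bilinear_form :: "('a \<Rightarrow> 'a \<Rightarrow> complex) \<Rightarrow> bool"
  where "even_bilinear_form F \<longleftrightarrow> bilinear_map scale (*) F \<and>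
    (\<forall>u\<in>V 0. \<forall>v\<in>V 1. F u v = 0 \<and> F v u = 0)"

definition non_degenerate :: "('a \<Rightarrow> 'a \<Rightarrow> complex) \<Rightarrow> bool"
  where "non_degenerate F \<longleftrightarrow>
    (\<forall>u. (\<forall>v. F u v = 0) \<longrightarrow> u = 0) \<and> (\<forall>v. (\<forall>u. F u v = 0) \<longrightarrow> v = 0)"

end

locale lie_superalgebra = super_vector_space scale V
  for scale :: "complex \<Rightarrow> 'a::ab_group_add \<Rightarrow> 'a" and V +
  fixes br :: "'a \<Rightarrow> 'a \<Rightarrow> 'a"
  assumes br_bilinear: "bilinear_map scale scale br"
    and br_even: "\<lbrakk>X \<in> V x; Y \<in> V y\<rbrakk> \<Longrightarrow> br X Y \<in> V (x + y)"
    and br_skew: "\<lbrakk>X \<in> V x; Y \<in> V y\<rbrakk> \<Longrightarrow> br X Y = - scale (koszul_sign x y) (br Y X)"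
    and br_jacobi: "\<lbrakk>X \<in> V x; Y \<in> V y; Z \<in> V z\<rbrakk> \<Longrightarrow>
      scale (koszul_sign x z) (br X (br Y Z)) + scale (koszul_sign x y) (br Y (br Z X))
        + scale (koszul_sign y z) (br Z (br X Y)) = 0"
begin

definition abelian :: bool
  where "abelian \<longleftrightarrow> (\<forall>X Y. br X Y = 0)"

definition invariant_scalar_product :: "('a \<Rightarrow> 'a \<Rightarrow> complex) \<Rightarrow> bool"
  where "invariant_scalar_product B \<longleftrightarrow>
    even_bilinear_form B \<and> non_degenerate B \<and>
    (\<forall>x y. \<forall>X\<in>V x. \<forall>Y\<in>V y. B X Y = koszul_sign x y * B Y X) \<and>
    (\<forall>X Y Z. B (br X Y) Z = B X (br Y Z))"

definition symplectic_structure :: "('a \<Rightarrow> 'a \<Rightarrow> complex) \<Rightarrow> bool"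
  where "symplectic_structure \<omega> \<longleftrightarrow>
    even_bilinear_form \<omega> \<and> non_degenerate \<omega> \<and>
    (\<forall>x y. \<forall>X\<in>V x. \<forall>Y\<in>V y. \<omega> X Y = - koszul_sign x y * \<omega> Y X) \<and>
    (\<forall>x y z. \<forall>X\<in>V x. \<forall>Y\<in>V y. \<forall>Z\<in>V z.
      koszul_sign x z * \<omega> X (br Y Z) + koszul_sign y x * \<omega> Y (br Z X)
        + koszul_sign z y * \<omega> Z (br X Y) = 0)"

end

locale quadratic_lie_superalgebra = lie_superalgebra scale V br
  for scale :: "complex \<Rightarrow> 'a::ab_group_add \<Rightarrow> 'a" and V br +
  fixes B :: "'a \<Rightarrow> 'a \<Rightarrow> complex"
  assumes invariant_scalar_product_B: "invariant_scalar_product B"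
begin

definition quadratic_symplectic :: bool
  where "quadratic_symplectic \<longleftrightarrow> (\<exists>\<omega>. symplectic_structure \<omega>)"

end

definition lie_superalgebra_isomorphism ::
    "(complex \<Rightarrow> 'a::ab_group_add \<Rightarrow> 'a) \<Rightarrow> (bit \<Rightarrow> 'a set) \<Rightarrow> ('a \<Rightarrow> 'a \<Rightarrow> 'a)
      \<Rightarrow> (complex \<Rightarrow> 'b::ab_group_add \<Rightarrow> 'b) \<Rightarrow> (bit \<Rightarrow> 'b set) \<Rightarrow> ('b \<Rightarrow> 'b \<Rightarrow> 'b)
      \<Rightarrow> ('a \<Rightarrow> 'b) \<Rightarrow> bool"
  where "lie_superalgebra_isomorphism s V br s' V' br' A \<longleftrightarrow>
    Vector_Spaces.linear s s' A \<and> bij A \<and> (\<forall>d. A ` V d = V' d) \<and>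
    (\<forall>X Y. A (br X Y) = br' (A X) (A Y))"

definition i_isomorphic ::
    "(complex \<Rightarrow> 'a::ab_group_add \<Rightarrow> 'a) \<Rightarrow> (bit \<Rightarrow> 'a set) \<Rightarrow> ('a \<Rightarrow> 'a \<Rightarrow> 'a) \<Rightarrow> ('a \<Rightarrow> 'a \<Rightarrow> complex)
      \<Rightarrow> (complex \<Rightarrow> 'b::ab_group_add \<Rightarrow> 'b) \<Rightarrow> (bit \<Rightarrow> 'b set) \<Rightarrow> ('b \<Rightarrow> 'b \<Rightarrow> 'b) \<Rightarrow> ('b \<Rightarrow> 'b \<Rightarrow> complex)
      \<Rightarrow> bool"
  where "i_isomorphic s V br B s' V' br' B' \<longleftrightarrow>
    (\<exists>A. lie_superalgebra_isomorphism s V br s' V' br' A \<and> (\<forall>X Y. B' (A X) (A Y) = B X Y))"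

text \<open>
  The algebra $\mathfrak{g}_{4,1}^s$, realised on the coordinate space over a four-element index
  type whose elements name the basis vectors $X_0, X_1, Y_1, Y_2$.
\<close>

datatype g41s_idx = iX0 | iX1 | iY1 | iY2

lemma UNIV_g41s_idx: "UNIV = {iX0, iX1, iY1, iY2}"
  using g41s_idx.exhaust by auto

instance g41s_idx :: finite
  by standard (simp add: UNIV_g41s_idx)

type_synonym g41s = "complex ^ g41s_idx"

abbreviation g41s_scale :: "complex \<Rightarrow> g41s \<Rightarrow> g41s"
  where "g41s_scale \<equiv> (*s)"

abbreviation g41s_basis :: "g41s_idx \<Rightarrow> g41s"
  where "g41s_basis i \<equiv> axis i 1"

definition g41s_V :: "bit \<Rightarrow> g41s set"
  where "g41s_V d = (if d = 0 then vec.span {g41s_basis iX0, g41s_basis iX1}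
    else vec.span {g41s_basis iY1, g41s_basis iY2})"

fun g41s_br_basis :: "g41s_idx \<Rightarrow> g41s_idx \<Rightarrow> g41s" where
  "g41s_br_basis iX1 iY1 = - 2 *s g41s_basis iY2"
| "g41s_br_basis iY1 iX1 = 2 *s g41s_basis iY2"
| "g41s_br_basis iY1 iY1 = - 2 *s g41s_basis iX0"
| "g41s_br_basis _ _ = 0"

definition g41s_br :: "g41s \<Rightarrow> g41s \<Rightarrow> g41s"
  where "g41s_br u v = (\<Sum>i\<in>UNIV. \<Sum>j\<in>UNIV. (u $ i * v $ j) *s g41s_br_basis i j)"

fun g41s_B_basis :: "g41s_idx \<Rightarrow> g41s_idx \<Rightarrow> complex" where
  "g41s_B_basis iX0 iX1 = 1"
| "g41s_B_basis iX1 iX0 = 1"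
| "g41s_B_basis iY2 iY1 = 1"
| "g41s_B_basis iY1 iY2 = - 1"
| "g41s_B_basis _ _ = 0"

definition g41s_B :: "g41s \<Rightarrow> g41s \<Rightarrow> complex"
  where "g41s_B u v = (\<Sum>i\<in>UNIV. \<Sum>j\<in>UNIV. u $ i * v $ j * g41s_B_basis i j)"

text \<open>
  Skew-supersymmetry makes the form below antisymmetric on even and symmetric on odd vectors.
\<close>

fun g41s_omega_basis :: "complex \<Rightarrow> complex \<Rightarrow> g41s_idx \<Rightarrow> g41s_idx \<Rightarrow> complex" where
  "g41s_omega_basis b1 b2 iX0 iX1 = 2 * b1"
| "g41s_omega_basis b1 b2 iX1 iX0 = - (2 * b1)"
| "g41s_omega_basis b1 b2 iY2 iY1 = - b1"
| "g41s_omega_basis b1 b2 iY1 iY2 = - b1"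
| "g41s_omega_basis b1 b2 iY1 iY1 = b2"
| "g41s_omega_basis b1 b2 _ _ = 0"

definition g41s_omega :: "complex \<Rightarrow> complex \<Rightarrow> g41s \<Rightarrow> g41s \<Rightarrow> complex"
  where "g41s_omega b1 b2 u v = (\<Sum>i\<in>UNIV. \<Sum>j\<in>UNIV. u $ i * v $ j * g41s_omega_basis b1 b2 i j)"

end

theory Submission
  imports Defs
begin

text \<open>
  Purely even case: $B([a,b],c)$ is an alternating 3-form on a 4-dimensional space, hence has a
  nonzero kernel vector $z$, which is central. The cocycle condition makes $\omega(z,\cdot)$ vanish
  on the derived algebra, so $\omega(z,\cdot) = \kappa B(z,\cdot)$ with $\kappa \neq 0$. Up to sign,
  $\kappa$ is the value of the cocycle expression on a triple $(a,b,c)$ with $B([a,b],c) = 1$, so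
  $\kappa = 0$, a contradiction.

  Case of dimensions $2 + 2$: the even part is abelian, and a non-abelian algebra has an odd $Y_1$
  with $[Y_1,Y_1] \neq 0$. The vectors $X_0 = -[Y_1,Y_1]/2$ (isotropic and central by the Jacobi
  identity and invariance), an isotropic even $X_1$ dual to $X_0$, and $Y_2 = -[X_1,Y_1]/2$ already
  satisfy all relations of $\mathfrak{g}_{4,1}^s$ up to one parameter $a$ with $[X_1,Y_2] = a Y_1$,
  and the existence of a symplectic form forces $a = 0$.
\<close>

section \<open>Bilinear maps, signs and dimension arguments\<close>

lemma bilinear_mapD:
  assumes "bilinear_map s t F"
  shows "F (u + v) w = F u w + F v w" "F w (u + v) = F w u + F w v"
    "F (s c u) v = t c (F u v)" "F u (s c v) = t c (F u v)"
    "F (u - v) w = F u w - F v w" "F w (u - v) = F w u - F w v"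
    "F (- u) v = - F u v" "F u (- v) = - F u v"
    "F 0 u = 0" "F u 0 = 0"
proof -
  have l: "Vector_Spaces.linear s t (F u)" "Vector_Spaces.linear s t (\<lambda>u. F u v)" for u v
    using assms by (auto simp: bilinear_map_def)
  have m: "module_hom s t (F u)" "module_hom s t (\<lambda>u. F u v)" for u v
    using l by (simp_all add: module_hom_iff_linear)
  show "F (u + v) w = F u w + F v w" "F w (u + v) = F w u + F w v"
    "F (s c u) v = t c (F u v)" "F u (s c v) = t c (F u v)"
    "F (u - v) w = F u w - F v w" "F w (u - v) = F w u - F w v"
    "F (- u) v = - F u v" "F u (- v) = - F u v"
    "F 0 u = 0" "F u 0 = 0"
    using module_hom.add[OF m(1)] module_hom.add[OF m(2)]
      module_hom.scale[OF m(1)] module_hom.scale[OF m(2)]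
      module_hom.diff[OF m(1)] module_hom.diff[OF m(2)]
      module_hom.neg[OF m(1)] module_hom.neg[OF m(2)]
      module_hom.zero[OF m(1)] module_hom.zero[OF m(2)] by simp_all
qed

lemma bilinear_mapI:
  assumes "vector_space s" "vector_space t"
    "\<And>u v w. F (u + v) w = F u w + F v w" "\<And>u v w. F w (u + v) = F w u + F w v"
    "\<And>c u v. F (s c u) v = t c (F u v)" "\<And>c u v. F u (s c v) = t c (F u v)"
  shows "bilinear_map s t F"
  unfolding bilinear_map_def Vector_Spaces.linear_iff using assms by simp

lemma bit_cases: "(d :: bit) = 0 \<or> d = 1"
  by auto

lemma koszul_sign_simps [simp]:
  "koszul_sign 0 x = 1" "koszul_sign x 0 = 1" "koszul_sign 1 1 = - 1"
  by (simp_all add: koszul_sign_def)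

context vector_space
begin

text \<open>A functional vanishing on \<open>S\<close> vanishes on its span, so \<open>a\<close>
  lies outside that span. The bases below are certified this way, with pairings by \<open>B\<close>
  as functionals.\<close>

lemma independent_insert_functional:
  assumes "independent S" and f: "Vector_Spaces.linear scale (*) f"
    and S: "\<And>x. x \<in> S \<Longrightarrow> f x = 0" and a: "f a \<noteq> 0"
  shows "independent (insert a S)"
proof -
  have "module_hom scale (*) f"
    using f by (simp add: module_hom_iff_linear)
  then have "f x = 0" if "x \<in> span S" for x
    using that S by (metis (full_types) module_hom.eq_0_on_span)
  then show ?thesis
    using a \<open>independent S\<close> by (auto simp: independent_insert)
qed

text \<open>A basis of \<open>W\<close> extending \<open>S\<close> has the same cardinality as
  \<open>S\<close>. Infinite sets have \<open>card\<close> 0, so \<open>dim W \<noteq> 0\<close>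
  makes both finite and hence equal.\<close>

lemma span_eq_of_card_eq_dim:
  assumes "independent S" "S \<subseteq> W" "subspace W" "card S = dim W" "dim W \<noteq> 0"
  shows "span S = W"
proof -
  obtain T where T: "S \<subseteq> T" "T \<subseteq> W" "independent T" "W \<subseteq> span T"
    using maximal_independent_subset_extend assms(1,2) by blast
  then have "card T = dim W"
    using basis_card_eq_dim by blast
  then have "S = T"
    using T(1) assms(4,5) by (metis card_subset_eq card.infinite)
  then show ?thesis
    using T assms(3) by (metis span_minimal subset_antisym)
qed

text \<open>\<open>dim\<close> is also 0 in infinite dimension; \<open>dim UNIV \<noteq> 0\<close>
  supplies a finite basis and with it the finite-dimensional theory.\<close>

lemma dim_zero_imp_trivial:
  assumes "dim UNIV \<noteq> 0" "dim W = 0" "v \<in> W"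
  shows "v = 0"
proof -
  obtain T where T: "independent T" "span T = UNIV" "card T = dim UNIV"
    by (metis basis_exists top.extremum_uniqueI)
  then have "finite T"
    using assms(1) by (metis card.infinite)
  then interpret finite_dimensional_vector_space scale T
    using T by unfold_locales auto
  show ?thesis
    using assms(2,3) by auto
qed

end

section \<open>Consequences of the axioms for homogeneous elements\<close>

context super_vector_space
begin

lemma bilinear_form_linear:
  assumes "bilinear_map scale (*) F"
  shows "Vector_Spaces.linear scale (*) (F u)" "Vector_Spaces.linear scale (*) (\<lambda>u. F u v)"
  using assms by (auto simp: bilinear_map_def)

end

context lie_superalgebra
begin

lemmas br_simps [simp] = bilinear_mapD [OF br_bilinear]

lemma even_skew: "X \<in> V 0 \<Longrightarrow> Y \<in> V y \<Longrightarrow> br X Y = - br Y X"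
  using br_skew[of X 0 Y y] by simp

lemma odd_sym: "X \<in> V 1 \<Longrightarrow> Y \<in> V 1 \<Longrightarrow> br X Y = br Y X"
  using br_skew[of X 1 Y 1] by simp

text \<open>The carrier is only an abelian group; the absence of 2-torsion comes from the invertible
  scalar 2.\<close>

lemma eq_neg_self_imp_zero: "v = - v \<Longrightarrow> v = (0 :: 'a)"
proof -
  assume "v = - v"
  then have "scale 2 v = 0"
    using scale_left_distrib[of 1 1 v] by (metis add.right_inverse one_add_one scale_one)
  then show ?thesis by simp
qed

lemma even_self: "X \<in> V 0 \<Longrightarrow> br X X = 0"
  by (metis even_skew eq_neg_self_imp_zero)

lemma symplectic_structureD:
  assumes "symplectic_structure \<omega>"
  shows "bilinear_map scale (*) \<omega>"
    "X \<in> V 0 \<Longrightarrow> Y \<in> V 1 \<Longrightarrow> \<omega> X Y = 0" "X \<in> V 0 \<Longrightarrow> Y \<in> V 1 \<Longrightarrow> \<omega> Y X = 0"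
    "(\<And>v. \<omega> u v = 0) \<Longrightarrow> u = 0"
    "X \<in> V x \<Longrightarrow> Y \<in> V y \<Longrightarrow> \<omega> X Y = - koszul_sign x y * \<omega> Y X"
    "X \<in> V x \<Longrightarrow> Y \<in> V y \<Longrightarrow> Z \<in> V z \<Longrightarrow>
      koszul_sign x z * \<omega> X (br Y Z) + koszul_sign y x * \<omega> Y (br Z X)
        + koszul_sign z y * \<omega> Z (br X Y) = 0"
  using assms
  unfolding symplectic_structure_def even_bilinear_form_def non_degenerate_def by blast+

end

context quadratic_lie_superalgebra
begin

lemma B_even_form: "even_bilinear_form B"
  using invariant_scalar_product_B unfolding invariant_scalar_product_def by blast

lemma B_bilinear: "bilinear_map scale (*) B"
  using B_even_form by (simp add: even_bilinear_form_def)

lemmas B_simps [simp] = bilinear_mapD [OF B_bilinear]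
lemmas B_linear = bilinear_form_linear [OF B_bilinear]

lemma B_inv: "B (br X Y) Z = B X (br Y Z)"
  using invariant_scalar_product_B unfolding invariant_scalar_product_def by blast

lemma B_even_odd [simp]: "X \<in> V 0 \<Longrightarrow> Y \<in> V 1 \<Longrightarrow> B X Y = 0" "X \<in> V 0 \<Longrightarrow> Y \<in> V 1 \<Longrightarrow> B Y X = 0"
  using B_even_form by (auto simp: even_bilinear_form_def)

lemma B_supersym: "X \<in> V x \<Longrightarrow> Y \<in> V y \<Longrightarrow> B X Y = koszul_sign x y * B Y X"
  using invariant_scalar_product_B unfolding invariant_scalar_product_def by blast

lemma B_even_sym: "X \<in> V 0 \<Longrightarrow> Y \<in> V 0 \<Longrightarrow> B X Y = B Y X"
  using B_supersym[of X 0 Y 0] by simp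

lemma B_odd_skew: "X \<in> V 1 \<Longrightarrow> Y \<in> V 1 \<Longrightarrow> B X Y = - B Y X"
  using B_supersym[of X 1 Y 1] by simp

lemma B_nondeg: "(\<And>v. B u v = 0) \<Longrightarrow> u = 0"
  using invariant_scalar_product_B unfolding invariant_scalar_product_def non_degenerate_def by blast

text \<open>Evenness of \<open>B\<close> kills the pairing with the other degree, so testing within
  one degree suffices.\<close>

lemma B_nondeg_homogeneous:
  assumes "u \<in> V d" "\<And>v. v \<in> V d \<Longrightarrow> B u v = 0"
  shows "u = 0"
proof (rule B_nondeg)
  fix w
  obtain w0 w1 where w: "w0 \<in> V 0" "w1 \<in> V 1" "w = w0 + w1"
    using V_sum by blast
  show "B u w = 0"
    using bit_cases[of d]
  proof
    assume "d = 0"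
    then show ?thesis using assms w by simp
  next
    assume "d = 1"
    then show ?thesis using assms w by simp
  qed
qed

section \<open>Purely even algebras of dimension 4\<close>

lemma purely_even_not_symplectic:
  assumes dim: "dim UNIV = 4" and odd: "dim (V 1) = 0" and "\<not> abelian"
  shows "\<not> quadratic_symplectic"
proof
  assume quadratic_symplectic
  then obtain \<omega> where \<omega>: "symplectic_structure \<omega>"
    by (auto simp: quadratic_symplectic_def)
  have "v = 0" if "v \<in> V 1" for v
    using dim_zero_imp_trivial[OF _ odd that] dim by simp
  then have ev: "v \<in> V 0" for v
  proof -
    obtain v0 v1 where "v0 \<in> V 0" "v1 \<in> V 1" "v = v0 + v1"
      using V_sum by blast
    with \<open>\<And>v. v \<in> V 1 \<Longrightarrow> v = 0\<close> show ?thesis by force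
  qed
  note [simp] = bilinear_mapD[OF symplectic_structureD(1)[OF \<omega>]]
  note \<omega>_nondeg = symplectic_structureD(4)[OF \<omega>]
  have \<omega>_skew: "\<omega> x y = - \<omega> y x" for x y
    using symplectic_structureD(5)[OF \<omega> ev ev, of x y] by simp
  have \<omega>_self [simp]: "\<omega> x x = 0" for x
    using \<omega>_skew[of x x] by simp
  have \<omega>_cocycle: "\<omega> x (br y w) + \<omega> y (br w x) + \<omega> w (br x y) = 0" for x y w
    using symplectic_structureD(6)[OF \<omega> ev ev ev, of x y w] by simp
  have Bs: "B x y = B y x" for x y
    by (rule B_even_sym) (rule ev)+
  have sk: "br x y = - br y x" for x y
    by (rule even_skew) (rule ev)+
  have [simp]: "br x x = 0" for x
    by (rule even_self) (rule ev)
  have cyc: "B x (br y w) = B w (br x y)" for x y w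
    using B_inv[of x y w] Bs[of w "br x y"] by simp
  \<comment> \<open>Invariance and \<open>br x x = 0\<close> make the cyclic form
    \<open>B x (br y w)\<close> alternating.\<close>
  have alt [simp]: "B x (br x y) = 0" "B x (br y x) = 0" for x y
    using B_inv[of x x y] cyc[of x y x] by simp_all

  obtain a' b where "br a' b \<noteq> 0"
    using \<open>\<not> abelian\<close> by (auto simp: abelian_def)
  then obtain c where nz: "B (br a' b) c \<noteq> 0"
    using B_nondeg by blast
  \<comment> \<open>Rescaling normalises the alternating 3-form to 1 on
    \<open>(a, b, c)\<close>.\<close>
  define a where "a = scale (1 / B (br a' b) c) a'"
  have abc: "B a (br b c) = 1"
    using nz by (simp add: a_def B_inv)
  define p q r where pqr: "p = br b c" "q = br c a" "r = br a b"
  have dual [simp]: "B a p = 1" "B b q = 1" "B c r = 1" "B b p = 0" "B c p = 0"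
    "B a q = 0" "B c q = 0" "B a r = 0" "B b r = 0"
    using abc by (simp_all add: pqr) (metis cyc)+
  have "span {a, b, c} \<noteq> UNIV"
  proof
    assume "span {a, b, c} = UNIV"
    then have "dim UNIV \<le> card {a, b, c}"
      by (intro dim_le_card) auto
    then show False
      using dim by (auto simp: card_insert_if split: if_splits)
  qed
  then obtain d where d: "d \<notin> span {a, b, c}" by blast
  \<comment> \<open>\<open>(a, b, c)\<close> is dual to \<open>(p, q, r)\<close> with respect to \<open>B\<close>, so this is orthogonal to the derived algebra.\<close>
  define z where "z = d - scale (B d p) a - scale (B d q) b - scale (B d r) c"
  have "z \<noteq> 0"
  proof
    assume "z = 0"
    then have "d = scale (B d p) a + scale (B d q) b + scale (B d r) c"
      by (simp add: z_def algebra_simps)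
    also have "\<dots> \<in> span {a, b, c}"
      by (intro span_add span_scale span_base) auto
    finally show False using d by simp
  qed
  have z [simp]: "B z p = 0" "B z q = 0" "B z r = 0"
    by (simp_all add: z_def)
  have distinct: "a \<noteq> b" "a \<noteq> c" "b \<noteq> c" "z \<noteq> a" "z \<noteq> b" "z \<noteq> c"
    using dual z by (metis zero_neq_one)+
  \<comment> \<open>Pairing with \<open>r\<close>, \<open>q\<close>, \<open>p\<close> in turn
    detects \<open>c\<close>, \<open>b\<close>, \<open>a\<close> and kills the vectors already
    present.\<close>
  have "independent {z}"
    using \<open>z \<noteq> 0\<close> by simp
  then have "independent {c, z}"
    by (rule independent_insert_functional[OF _ B_linear(2)[of r]]) auto
  then have "independent {b, c, z}"
    by (rule independent_insert_functional[OF _ B_linear(2)[of q]]) auto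
  then have "independent {a, b, c, z}"
    by (rule independent_insert_functional[OF _ B_linear(2)[of p]]) auto
  then have "span {a, b, c, z} = UNIV"
    using span_eq_of_card_eq_dim[of "{a, b, c, z}" UNIV] distinct dim by auto
  then have exp0: "\<exists>k1 k2 k3 k4. v = scale k1 a + scale k2 b + scale k3 c + scale k4 z" for v
  proof -
    have "v \<in> span {a, b, c, z}"
      using \<open>span {a, b, c, z} = UNIV\<close> by simp
    then show ?thesis
      by (auto simp: span_insert algebra_simps) 
  qed
  then have exp: "\<exists>k. v = scale (B v p) a + scale (B v q) b + scale (B v r) c + scale k z" for v
  proof -
    obtain k1 k2 k3 k4 where v: "v = scale k1 a + scale k2 b + scale k3 c + scale k4 z"
      using exp0 by blast
    have "B v p = k1" "B v q = k2" "B v r = k3"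
      by (simp_all add: v)
    then show ?thesis
      using v by blast
  qed
  \<comment> \<open>Expand both arguments: brackets among \<open>a\<close>, \<open>b\<close>,
    \<open>c\<close> are zero or, up to sign, \<open>p\<close>, \<open>q\<close>, \<open>r\<close>,
    all orthogonal to \<open>z\<close>; brackets involving \<open>z\<close> are covered by
    \<open>alt\<close>.\<close>
  have zr: "B z (br x y) = 0" for x y
  proof -
    obtain k1 k2 k3 k4 where x: "x = scale k1 a + scale k2 b + scale k3 c + scale k4 z"
      using exp0 by blast
    obtain l1 l2 l3 l4 where y: "y = scale l1 a + scale l2 b + scale l3 c + scale l4 z"
      using exp0 by blast
    have [simp]: "br b a = - r" "br c b = - p" "br a c = - q" "br a b = r" "br b c = p" "br c a = q"
      using sk pqr by metis+
    show ?thesis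
      by (simp add: x y)
  qed
  have central: "br z x = 0" for x
    by (rule B_nondeg) (simp add: B_inv zr)
  \<comment> \<open>Centrality of \<open>z\<close> removes the other two terms of the cocycle
    identity.\<close>
  have \<omega>z: "\<omega> z (br x y) = 0" for x y
    using \<omega>_cocycle[of z x y] central sk[of y z] by simp
  obtain d' where d': "B z d' \<noteq> 0"
    using B_nondeg \<open>z \<noteq> 0\<close> by blast
  have "independent {r}"
    by (rule independent_insert_functional[OF independent_empty B_linear(1)[of c]]) auto
  then have "independent {q, r}"
    by (rule independent_insert_functional[OF _ B_linear(1)[of b]]) auto
  then have "independent {p, q, r}"
    by (rule independent_insert_functional[OF _ B_linear(1)[of a]]) auto
  then have ind: "independent {d', p, q, r}"
    by (rule independent_insert_functional[OF _ B_linear(1)[of z]]) (use d' in auto)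
  have "d' \<noteq> p" "d' \<noteq> q" "d' \<noteq> r" "p \<noteq> q" "p \<noteq> r" "q \<noteq> r"
    using d' dual z by (metis zero_neq_one)+
  then have "span {d', p, q, r} = UNIV"
    using span_eq_of_card_eq_dim[OF ind] dim by auto
  \<comment> \<open>Both \<open>\<omega> z\<close> and \<open>B z\<close> vanish on
    \<open>p\<close>, \<open>q\<close>, \<open>r\<close>, which together with \<open>d'\<close> form
    a basis; hence they are proportional, with ratio read off at \<open>d'\<close>.\<close>
  define \<kappa> where "\<kappa> = \<omega> z d' / B z d'"
  have \<kappa>: "\<omega> z x = \<kappa> * B z x" for x
  proof -
    have "x \<in> span {d', p, q, r}"
      using \<open>span {d', p, q, r} = UNIV\<close> by simp
    then obtain k1 k2 k3 k4 where x: "x = scale k1 d' + scale k2 p + scale k3 q + scale k4 r"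
      by (auto simp: span_insert algebra_simps) 
    have "\<omega> z p = 0" "\<omega> z q = 0" "\<omega> z r = 0"
      using \<omega>z by (auto simp: pqr)
    then show ?thesis
      using d' by (simp add: x \<kappa>_def)
  qed
  have "\<kappa> \<noteq> 0"
    using \<kappa> \<omega>_nondeg[of z] \<open>z \<noteq> 0\<close> by auto
  \<comment> \<open>Skewness gives \<open>\<omega> z z = 0\<close>, so the proportionality makes
    \<open>z\<close> isotropic.\<close>
  then have zz [simp]: "B z z = 0"
    using \<kappa>[of z] by simp
  define \<alpha> \<beta> \<gamma> where abg: "\<alpha> = B z a" "\<beta> = B z b" "\<gamma> = B z c"
  \<comment> \<open>Since \<open>z\<close> is orthogonal to itself, both sides have the same
    pairings with the basis \<open>a\<close>, \<open>b\<close>, \<open>c\<close>, \<open>z\<close>.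
    Thus \<open>z\<close> lies in the derived algebra.\<close>
  have z_eq: "z = scale \<alpha> p + scale \<beta> q + scale \<gamma> r"
  proof -
    have "z - (scale \<alpha> p + scale \<beta> q + scale \<gamma> r) = 0"
    proof (rule B_nondeg)
      fix v
      obtain k1 k2 k3 k4 where v: "v = scale k1 a + scale k2 b + scale k3 c + scale k4 z"
        using exp0 by blast
      have [simp]: "B p a = 1" "B q b = 1" "B r c = 1" "B p b = 0" "B p c = 0"
        "B q a = 0" "B q c = 0" "B r a = 0" "B r b = 0" "B p z = 0" "B q z = 0" "B r z = 0"
        using dual z Bs by metis+
      show "B (z - (scale \<alpha> p + scale \<beta> q + scale \<gamma> r)) v = 0"
        by (simp add: v abg)
    qed
    then show ?thesis by simp
  qed
  obtain kp kq kr where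
    p: "p = scale (B p p) a + scale (B p q) b + scale (B p r) c + scale kp z" and
    q: "q = scale (B q p) a + scale (B q q) b + scale (B q r) c + scale kq z" and
    r: "r = scale (B r p) a + scale (B r q) b + scale (B r r) c + scale kr z"
    using exp by metis
  have coord: "\<alpha> * B p p + \<beta> * B q p + \<gamma> * B r p = 0"
    "\<alpha> * B p q + \<beta> * B q q + \<gamma> * B r q = 0"
    "\<alpha> * B p r + \<beta> * B q r + \<gamma> * B r r = 0"
    using arg_cong[OF z_eq, of "\<lambda>v. B v p"] arg_cong[OF z_eq, of "\<lambda>v. B v q"]
      arg_cong[OF z_eq, of "\<lambda>v. B v r"] by simp_all
  \<comment> \<open>Inserting the expansions of \<open>p\<close>, \<open>q\<close>, \<open>r\<close>
    cancels the coefficients of \<open>a\<close>, \<open>b\<close>, \<open>c\<close> by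
    \<open>coord\<close>; comparing those of \<open>z\<close> gives \<open>one\<close>.\<close>
  have "z = scale \<alpha> p + scale \<beta> q + scale \<gamma> r"
    by (rule z_eq)
  also have "\<dots> = scale (\<alpha> * B p p + \<beta> * B q p + \<gamma> * B r p) a
      + scale (\<alpha> * B p q + \<beta> * B q q + \<gamma> * B r q) b
      + scale (\<alpha> * B p r + \<beta> * B q r + \<gamma> * B r r) c
      + scale (\<alpha> * kp + \<beta> * kq + \<gamma> * kr) z"
    by (subst p, subst q, subst r) (simp add: scale_left_distrib scale_right_distrib algebra_simps)
  finally have "scale (\<alpha> * kp + \<beta> * kq + \<gamma> * kr) z = scale 1 z"
    by (simp add: coord)
  then have one: "\<alpha> * kp + \<beta> * kq + \<gamma> * kr = 1"
    using \<open>z \<noteq> 0\<close> scale_cancel_right by blast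
  have \<omega>abc: "\<omega> a z = - \<kappa> * \<alpha>" "\<omega> b z = - \<kappa> * \<beta>" "\<omega> c z = - \<kappa> * \<gamma>"
    using \<omega>_skew[of _ z] \<kappa> by (simp_all add: abg)
  \<comment> \<open>The coefficients \<open>B p q\<close>, \<open>B p r\<close>, \<open>B q r\<close> are symmetric and \<open>\<omega>\<close> is skew, so only the \<open>z\<close>-components survive.\<close>
  have "\<omega> a p + \<omega> b q + \<omega> c r = 0"
    using \<omega>_cocycle[of a b c] by (simp add: pqr)
  moreover have "\<omega> a p = B p q * \<omega> a b + B p r * \<omega> a c + kp * \<omega> a z"
    by (subst p) simp
  moreover have "\<omega> b q = - B p q * \<omega> a b + B q r * \<omega> b c + kq * \<omega> b z"
    by (subst q) (simp add: \<omega>_skew[of b a] Bs[of q p])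
  moreover have "\<omega> c r = - B p r * \<omega> a c - B q r * \<omega> b c + kr * \<omega> c z"
    by (subst r) (simp add: \<omega>_skew[of c a] \<omega>_skew[of c b] Bs[of r p] Bs[of r q])
  ultimately have "\<kappa> * (\<alpha> * kp + \<beta> * kq + \<gamma> * kr) = 0"
    unfolding \<omega>abc by algebra
  then show False
    using one \<open>\<kappa> \<noteq> 0\<close> by simp
qed


section \<open>Dimensions 2 + 2: construction of an adapted basis\<close>

lemma even_part_abelian:
  assumes "dim (V 0) = 2" and X: "X \<in> V 0" and Y: "Y \<in> V 0"
  shows "br X Y = 0"
proof (rule ccontr)
  assume nz: "br X Y \<noteq> 0"
  have "Y \<noteq> 0" using nz by auto
  then have "independent {Y}" by simp
  moreover have "X \<notin> span {Y}"
    using nz even_self[OF Y] by (auto simp: span_singleton)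
  ultimately have ind: "independent {X, Y}"
    by (simp add: independent_insert)
  have "X \<noteq> Y" using nz even_self[OF Y] by auto
  then have span: "span {X, Y} = V 0"
    using span_eq_of_card_eq_dim[OF ind _ subspace_V] X Y assms(1) by simp
  \<comment> \<open>Invariance reduces these to \<open>br X X\<close> and \<open>br Y Y\<close>; so
    \<open>br X Y\<close> is orthogonal to the basis \<open>X\<close>, \<open>Y\<close> of the even
    part.\<close>
  have "B (br Y X) X = 0" "B (br X Y) Y = 0"
    by (simp_all add: B_inv even_self X Y)
  then have "B (br X Y) X = 0" "B (br X Y) Y = 0"
    using even_skew[OF X Y] by simp_all
  then have "B (br X Y) v = 0" if "v \<in> V 0" for v
    using that unfolding span[symmetric] by (auto simp: span_insert algebra_simps)
  then have "br X Y = 0"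
    using B_nondeg_homogeneous[of _ 0] br_even[OF X Y] by simp
  with nz show False by simp
qed

text \<open>If all odd squares vanished, polarisation would kill odd-odd brackets and then
  invariance the even-odd ones; the even part is already abelian.\<close>

lemma odd_square_nonzero:
  assumes "dim (V 0) = 2" "\<not> abelian"
  obtains Y where "Y \<in> V 1" "br Y Y \<noteq> 0"
proof -
  have "\<exists>Y\<in>V 1. br Y Y \<noteq> 0"
  proof (rule ccontr)
    assume "\<not> ?thesis"
    then have sq: "br Y Y = 0" if "Y \<in> V 1" for Y
      using that by blast
    have odd: "br Y Y' = 0" if "Y \<in> V 1" "Y' \<in> V 1" for Y Y'
    proof -
      have "br (Y + Y') (Y + Y') = 0"
        using that subspace_V by (intro sq subspace_add)
      then have "br Y Y' + br Y' Y = 0"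
        using that by (simp add: sq add.commute)
      then show ?thesis
        using odd_sym[OF that] by (metis eq_neg_iff_add_eq_0 eq_neg_self_imp_zero)
    qed
    have mixed: "br X Y = 0" if "X \<in> V 0" "Y \<in> V 1" for X Y
      using that br_even[of X 0 Y 1]
      by (intro B_nondeg_homogeneous[of _ 1]) (auto simp: B_inv odd)
    have "br u v = 0" for u v
    proof -
      obtain u0 u1 v0 v1 where uv: "u0 \<in> V 0" "u1 \<in> V 1" "u = u0 + u1"
        "v0 \<in> V 0" "v1 \<in> V 1" "v = v0 + v1"
        using V_sum[of u] V_sum[of v] by blast
      have "br u1 v0 = 0"
        using even_skew[of v0 u1 1] mixed uv by simp
      then show ?thesis
        using uv even_part_abelian[OF assms(1)] mixed odd by simp
    qed
    then show False
      using \<open>\<not> abelian\<close> by (simp add: abelian_def)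
  qed
  then show ?thesis
    using that by blast
qed

text \<open>Normalisations are dictated by the table of \<open>g41s\<close>. The form
  \<open>\<omega>\<close> enters only at the end, to remove the last parameter
  \<open>a\<close>.\<close>

lemma symplectic_frame:
  assumes d0: "dim (V 0) = 2" and d1: "dim (V 1) = 2" and "\<not> abelian" and \<omega>: "symplectic_structure \<omega>"
  obtains X0 X1 Y1 Y2 where
    "X0 \<in> V 0" "X1 \<in> V 0" "Y1 \<in> V 1" "Y2 \<in> V 1"
    "B X0 X0 = 0" "B X0 X1 = 1" "B X1 X1 = 0" "B Y2 Y1 = 1"
    "br X0 X1 = 0" "br X0 Y1 = 0" "br X0 Y2 = 0"
    "br X1 Y1 = scale (- 2) Y2" "br X1 Y2 = 0"
    "br Y1 Y1 = scale (- 2) X0" "br Y1 Y2 = 0" "br Y2 Y2 = 0"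
    "\<And>v. v \<in> V 0 \<Longrightarrow> \<exists>k l. v = scale k X0 + scale l X1"
    "\<And>v. v \<in> V 1 \<Longrightarrow> \<exists>k l. v = scale k Y1 + scale l Y2"
proof -
  note [simp] = bilinear_mapD[OF symplectic_structureD(1)[OF \<omega>]] symplectic_structureD(2,3)[OF \<omega>]
  note even_ab = even_part_abelian[OF d0]
  obtain Y1 where Y1 [simp]: "Y1 \<in> V 1" and nz: "br Y1 Y1 \<noteq> 0"
    using odd_square_nonzero[OF d0 \<open>\<not> abelian\<close>] by blast
  have B_odd_self: "B Y Y = 0" if "Y \<in> V 1" for Y
    using B_odd_skew[OF that that] by simp
  define X0 where "X0 = scale (- 1 / 2) (br Y1 Y1)"
  have Y1Y1: "br Y1 Y1 = scale (- 2) X0"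
    by (simp add: X0_def)
  have X0 [simp]: "X0 \<in> V 0"
    using br_even[of Y1 1 Y1 1] subspace_V by (simp add: X0_def subspace_scale subspace_neg)
  have "X0 \<noteq> 0"
    using nz Y1Y1 by auto
  \<comment> \<open>For three equal odd arguments every Jacobi sign is -1, so three times the double
    bracket vanishes.\<close>
  have "br Y1 X0 = 0"
  proof -
    let ?W = "br Y1 (br Y1 Y1)"
    have "scale (- 1) ?W + scale (- 1) ?W + scale (- 1) ?W = 0"
      using br_jacobi[OF Y1 Y1 Y1] unfolding koszul_sign_simps(3) .
    then have "scale (- 3) ?W = 0"
      by (simp only: scale_left_distrib[symmetric]) simp
    then show ?thesis by (simp add: X0_def)
  qed
  then have X0Y1: "br X0 Y1 = 0"
    using even_skew[of X0 Y1 1] by simp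
  then have BX00: "B X0 X0 = 0"
    using B_inv[of X0 Y1 Y1] by (simp add: X0_def)
  obtain X where X: "X \<in> V 0" "B X0 X \<noteq> 0"
    using B_nondeg_homogeneous[OF X0] \<open>X0 \<noteq> 0\<close> by blast
  define X' where "X' = scale (1 / B X0 X) X"
  have X': "X' \<in> V 0" "B X0 X' = 1"
    using X subspace_V by (auto simp: X'_def subspace_scale)
  \<comment> \<open>The correction along the isotropic \<open>X0\<close> removes
    \<open>B X' X'\<close> and keeps the pairing with \<open>X0\<close> equal to 1.\<close>
  define X1 where "X1 = X' - scale (B X' X' / 2) X0"
  have X1 [simp]: "X1 \<in> V 0"
    using X' subspace_V by (simp add: X1_def subspace_diff subspace_scale)
  have BX01: "B X0 X1 = 1"
    using X' BX00 by (simp add: X1_def)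
  have BX11: "B X1 X1 = 0"
    using X' BX00 B_even_sym[OF X0 X'(1)] by (simp add: X1_def)
  define Y2 where "Y2 = scale (- 1 / 2) (br X1 Y1)"
  have X1Y1: "br X1 Y1 = scale (- 2) Y2"
    by (simp add: Y2_def)
  have Y2 [simp]: "Y2 \<in> V 1"
    using br_even[of X1 0 Y1 1] subspace_V by (simp add: Y2_def subspace_scale subspace_neg)
  have BX10: "B X1 X0 = 1"
    using BX01 B_even_sym[of X0 X1] by simp
  have BY21: "B Y2 Y1 = 1"
    using BX10 by (simp add: Y2_def B_inv Y1Y1)
  have BY12: "B Y1 Y2 = - 1"
    using BY21 B_odd_skew[of Y1 Y2] by simp
  note B_vals [simp] = BX00 BX01 BX10 BX11 BY12 BY21 B_odd_self[OF Y1] B_odd_self[OF Y2]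
  have "independent {X1}"
    by (rule independent_insert_functional[OF independent_empty B_linear(1)[of X0]]) auto
  then have ind0: "independent {X0, X1}"
    by (rule independent_insert_functional[OF _ B_linear(1)[of X1]]) auto
  have "X0 \<noteq> X1" using BX00 BX01 by (metis zero_neq_one)
  then have "span {X0, X1} = V 0"
    using span_eq_of_card_eq_dim[OF ind0 _ subspace_V] d0 by simp
  then have exp0: "\<exists>k l. v = scale k X0 + scale l X1" if "v \<in> V 0" for v
    using that by (auto simp: span_insert algebra_simps)
  have "independent {Y2}"
    by (rule independent_insert_functional[OF independent_empty B_linear(1)[of Y1]]) auto
  then have ind1: "independent {Y1, Y2}"
    by (rule independent_insert_functional[OF _ B_linear(1)[of Y2]]) auto
  have "Y1 \<noteq> Y2" using B_vals by (metis zero_neq_one)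
  then have "span {Y1, Y2} = V 1"
    using span_eq_of_card_eq_dim[OF ind1 _ subspace_V] d1 by simp
  then have exp1: "\<exists>k l. v = scale k Y1 + scale l Y2" if "v \<in> V 1" for v
    using that by (auto simp: span_insert algebra_simps)

  have X01: "br X0 X1 = 0"
    by (simp add: even_ab)
  \<comment> \<open>Jacobi on \<open>X0\<close>, \<open>X1\<close>, \<open>Y1\<close>: two of the
    double brackets vanish, leaving a multiple of \<open>br X0 Y2\<close>.\<close>
  have X0Y2: "br X0 Y2 = 0"
    using br_jacobi[of X0 0 X1 0 Y1 1] X01 X0Y1 \<open>br Y1 X0 = 0\<close> by (simp add: Y2_def)
  have Y12: "br Y1 Y2 = 0"
  proof (rule B_nondeg_homogeneous[of _ 0])
    fix v assume "v \<in> V 0"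
    then obtain k l where v: "v = scale k X0 + scale l X1"
      using exp0 by blast
    have "B X0 (br Y1 Y2) = 0" "B X1 (br Y1 Y2) = 0"
      by (simp_all add: B_inv[symmetric] X0Y1 X1Y1)
    moreover have "br Y1 Y2 \<in> V 0"
      using br_even[of Y1 1 Y2 1] by simp
    ultimately show "B (br Y1 Y2) v = 0"
      by (simp add: v B_even_sym[of "br Y1 Y2"])
  qed (use br_even[of Y1 1 Y2 1] in simp)
  obtain a b where ab: "br X1 Y2 = scale a Y1 + scale b Y2"
    using exp1[of "br X1 Y2"] br_even[OF X1 Y2] by auto
  \<comment> \<open>By invariance this is \<open>B X1 (br Y2 Y1)\<close>, while the expansion
    \<open>ab\<close> evaluates it to \<open>b\<close>.\<close>
  have "B (br X1 Y2) Y1 = 0"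
    using odd_sym[of Y2 Y1] by (simp add: B_inv Y12)
  then have "b = 0"
    by (simp add: ab)
  with ab have X1Y2: "br X1 Y2 = scale a Y1" by simp
  obtain k l where kl: "br Y2 Y2 = scale k X0 + scale l X1"
    using exp0[of "br Y2 Y2"] br_even[OF Y2 Y2] by auto
  have "B X0 (br Y2 Y2) = 0" "B X1 (br Y2 Y2) = - a"
    by (simp_all add: B_inv[symmetric] X0Y2 X1Y2)
  then have Y22: "br Y2 Y2 = scale (- a) X0"
    using kl by simp
  have Y1X1: "br Y1 X1 = scale 2 Y2"
    using even_skew[of X1 Y1 1] X1Y1 by (metis X1 Y1 minus_minus scale_minus_left)
  have Y2X1: "br Y2 X1 = scale (- a) Y1"
    using even_skew[of X1 Y2 1] X1Y2 by (metis X1 Y2 minus_minus scale_minus_left)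
  have \<omega>sk: "\<omega> X1 X0 = - \<omega> X0 X1" "\<omega> X0 X0 = 0" "\<omega> Y2 Y1 = \<omega> Y1 Y2"
    using symplectic_structureD(5)[OF \<omega>, of X1 0 X0 0]
      symplectic_structureD(5)[OF \<omega>, of X0 0 X0 0]
      symplectic_structureD(5)[OF \<omega>, of Y2 1 Y1 1] by simp_all
  \<comment> \<open>The cocycle identity on \<open>(X1, Y1, Y1)\<close> and on
    \<open>(X1, Y2, Y2)\<close> gives relations of opposite sign, so
    \<open>a * \<omega> X0 X1 = 0\<close>.\<close>
  have "2 * \<omega> X0 X1 + \<omega> Y1 Y2 * 4 = 0"
    using symplectic_structureD(6)[OF \<omega>, of X1 0 Y1 1 Y1 1]
    by (simp add: Y1Y1 Y1X1 X1Y1 \<omega>sk algebra_simps)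
  then have 1: "\<omega> X0 X1 = - 2 * \<omega> Y1 Y2"
    by algebra
  have 2: "a * \<omega> X0 X1 = 2 * a * \<omega> Y1 Y2"
    using symplectic_structureD(6)[OF \<omega>, of X1 0 Y2 1 Y2 1]
    by (simp add: Y22 Y2X1 X1Y2 \<omega>sk algebra_simps)
  \<comment> \<open>Otherwise \<open>X0\<close> would lie in the radical of
    \<open>\<omega>\<close>.\<close>
  have "\<omega> X0 X1 \<noteq> 0"
  proof
    assume z: "\<omega> X0 X1 = 0"
    have "\<omega> X0 v = 0" for v
    proof -
      obtain v0 v1 where v: "v0 \<in> V 0" "v1 \<in> V 1" "v = v0 + v1"
        using V_sum by blast
      obtain k l where "v0 = scale k X0 + scale l X1"
        using exp0 v(1) by blast
      with v z show ?thesis by (simp add: \<omega>sk)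
    qed
    then show False
      using symplectic_structureD(4)[OF \<omega>] \<open>X0 \<noteq> 0\<close> by blast
  qed
  with 1 2 have "a = 0" by auto
  show ?thesis
    by (rule that[of X0 X1 Y1 Y2])
      (use X01 X0Y1 X0Y2 X1Y1 X1Y2 Y1Y1 Y12 Y22 \<open>a = 0\<close> exp0 exp1 in simp_all)
qed

end

section \<open>The model algebra in coordinates and its symplectic forms\<close>

lemma all_g41s_idx: "(\<forall>i. P i) \<longleftrightarrow> P iX0 \<and> P iX1 \<and> P iY1 \<and> P iY2"
  by (metis g41s_idx.exhaust)

lemma g41s_eq_iff:
  "(u :: g41s) = v \<longleftrightarrow> u $ iX0 = v $ iX0 \<and> u $ iX1 = v $ iX1 \<and> u $ iY1 = v $ iY1 \<and> u $ iY2 = v $ iY2"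
  by (simp add: vec_eq_iff all_g41s_idx)

lemma sum_g41s_idx: "(\<Sum>i\<in>UNIV. f i) = f iX0 + f iX1 + f iY1 + f iY2"
  by (simp add: UNIV_g41s_idx add.assoc)

lemma g41s_basis_nth [simp]: "g41s_basis i $ j = (if i = j then 1 else 0)"
  by (simp add: axis_def eq_commute)

lemma g41s_expansion:
  "(u :: g41s) = u $ iX0 *s g41s_basis iX0 + u $ iX1 *s g41s_basis iX1
    + u $ iY1 *s g41s_basis iY1 + u $ iY2 *s g41s_basis iY2"
  by (simp add: g41s_eq_iff)

lemma g41s_V_even: "u \<in> g41s_V 0 \<longleftrightarrow> u $ iY1 = 0 \<and> u $ iY2 = 0"
proof
  assume "u \<in> g41s_V 0"
  then obtain k l where "u = k *s g41s_basis iX0 + l *s g41s_basis iX1"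
    by (auto simp: g41s_V_def vec.span_insert algebra_simps)
  then show "u $ iY1 = 0 \<and> u $ iY2 = 0"
    by simp
next
  assume "u $ iY1 = 0 \<and> u $ iY2 = 0"
  then have "u = u $ iX0 *s g41s_basis iX0 + u $ iX1 *s g41s_basis iX1"
    by (simp add: g41s_eq_iff)
  also have "\<dots> \<in> g41s_V 0"
    unfolding g41s_V_def by (simp, intro vec.span_add vec.span_scale vec.span_base) simp_all
  finally show "u \<in> g41s_V 0" .
qed

lemma g41s_V_odd: "u \<in> g41s_V 1 \<longleftrightarrow> u $ iX0 = 0 \<and> u $ iX1 = 0"
proof
  assume "u \<in> g41s_V 1"
  then obtain k l where "u = k *s g41s_basis iY1 + l *s g41s_basis iY2"
    by (auto simp: g41s_V_def vec.span_insert algebra_simps)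
  then show "u $ iX0 = 0 \<and> u $ iX1 = 0"
    by simp
next
  assume "u $ iX0 = 0 \<and> u $ iX1 = 0"
  then have "u = u $ iY1 *s g41s_basis iY1 + u $ iY2 *s g41s_basis iY2"
    by (simp add: g41s_eq_iff)
  also have "\<dots> \<in> g41s_V 1"
    unfolding g41s_V_def by (simp, intro vec.span_add vec.span_scale vec.span_base) simp_all
  finally show "u \<in> g41s_V 1" .
qed

lemma g41s_br_nth [simp]:
  "g41s_br u v $ iX0 = - 2 * u $ iY1 * v $ iY1" "g41s_br u v $ iX1 = 0"
  "g41s_br u v $ iY1 = 0" "g41s_br u v $ iY2 = 2 * u $ iY1 * v $ iX1 - 2 * u $ iX1 * v $ iY1"
  by (simp_all add: g41s_br_def sum_g41s_idx)

lemma g41s_B_eq: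
  "g41s_B u v = u $ iX0 * v $ iX1 + u $ iX1 * v $ iX0 + u $ iY2 * v $ iY1 - u $ iY1 * v $ iY2"
  by (simp add: g41s_B_def sum_g41s_idx)

lemma g41s_omega_eq:
  "g41s_omega b1 b2 u v = 2 * b1 * (u $ iX0 * v $ iX1 - u $ iX1 * v $ iX0)
    - b1 * (u $ iY2 * v $ iY1 + u $ iY1 * v $ iY2) + b2 * u $ iY1 * v $ iY1"
  by (simp add: g41s_omega_def sum_g41s_idx algebra_simps)

lemma vector_space_complex: "vector_space ((*) :: complex \<Rightarrow> complex \<Rightarrow> complex)"
  by unfold_locales (auto simp: algebra_simps)

interpretation g41s: lie_superalgebra g41s_scale g41s_V g41s_br
proof
  fix d show "vec.subspace (g41s_V d)"
    by (simp add: g41s_V_def vec.subspace_span)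
next
  fix w :: g41s
  have "w = (w $ iX0 *s g41s_basis iX0 + w $ iX1 *s g41s_basis iX1)
      + (w $ iY1 *s g41s_basis iY1 + w $ iY2 *s g41s_basis iY2)"
    by (simp add: g41s_eq_iff)
  then show "\<exists>u\<in>g41s_V 0. \<exists>v\<in>g41s_V 1. w = u + v"
    by (intro bexI) (auto simp: g41s_V_even g41s_V_odd)
next
  show "g41s_V 0 \<inter> g41s_V 1 = {0}"
    by (auto simp: g41s_V_even g41s_V_odd g41s_eq_iff)
next
  show "bilinear_map g41s_scale g41s_scale g41s_br"
    by (rule bilinear_mapI) (simp_all add: vec.vector_space_axioms g41s_eq_iff algebra_simps)
next
  fix X Y :: g41s and x y
  assume "X \<in> g41s_V x" "Y \<in> g41s_V y"
  then show "g41s_br X Y \<in> g41s_V (x + y)"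
    and "g41s_br X Y = - (koszul_sign x y *s g41s_br Y X)"
    using bit_cases[of x] bit_cases[of y]
    by (auto simp: g41s_V_even g41s_V_odd g41s_eq_iff)
next
  \<comment> \<open>Every bracket lies in the span of the central vectors X0 and Y2, so each double
    bracket is zero.\<close>
  fix X Y Z :: g41s and x y z
  assume "X \<in> g41s_V x" "Y \<in> g41s_V y" "Z \<in> g41s_V z"
  then show "koszul_sign x z *s g41s_br X (g41s_br Y Z) + koszul_sign x y *s g41s_br Y (g41s_br Z X)
      + koszul_sign y z *s g41s_br Z (g41s_br X Y) = 0"
    using bit_cases[of x] bit_cases[of y] bit_cases[of z]
    by (auto simp: g41s_V_even g41s_V_odd g41s_eq_iff)
qed

interpretation g41s: quadratic_lie_superalgebra g41s_scale g41s_V g41s_br g41s_B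
proof
  have bil: "bilinear_map g41s_scale (*) g41s_B"
    by (rule bilinear_mapI)
      (simp_all add: vec.vector_space_axioms vector_space_complex g41s_B_eq algebra_simps)
  have "u = 0" if "\<And>v. g41s_B u v = 0" for u
    using that[of "g41s_basis iX0"] that[of "g41s_basis iX1"]
      that[of "g41s_basis iY1"] that[of "g41s_basis iY2"]
    by (simp add: g41s_B_eq g41s_eq_iff)
  moreover have "v = 0" if "\<And>u. g41s_B u v = 0" for v
    using that[of "g41s_basis iX0"] that[of "g41s_basis iX1"]
      that[of "g41s_basis iY1"] that[of "g41s_basis iY2"]
    by (simp add: g41s_B_eq g41s_eq_iff)
  ultimately have nd: "g41s.non_degenerate g41s_B"
    unfolding g41s.non_degenerate_def by blast
  have sym: "g41s_B X Y = koszul_sign x y * g41s_B Y X" if "X \<in> g41s_V x" "Y \<in> g41s_V y" for X Y x y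
    using that bit_cases[of x] bit_cases[of y]
    by (auto simp: g41s_V_even g41s_V_odd g41s_B_eq algebra_simps)
  have inv: "g41s_B (g41s_br X Y) Z = g41s_B X (g41s_br Y Z)" for X Y Z
    by (simp add: g41s_B_eq algebra_simps)
  have ev: "g41s.even_bilinear_form g41s_B"
    using bil by (auto simp: g41s.even_bilinear_form_def g41s_V_even g41s_V_odd g41s_B_eq)
  show "g41s.invariant_scalar_product g41s_B"
    unfolding g41s.invariant_scalar_product_def using ev nd sym inv by blast
qed

text \<open>Pairing with basis vectors recovers all coordinates up to nonzero multiples of
  \<open>b1\<close>; \<open>b2\<close> only adds a triangular term.\<close>

lemma g41s_omega_symplectic:
  assumes "b1 \<noteq> 0"
  shows "g41s.symplectic_structure (g41s_omega b1 b2)"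
proof -
  let ?\<omega> = "g41s_omega b1 b2"
  have bil: "bilinear_map g41s_scale (*) ?\<omega>"
    by (rule bilinear_mapI)
      (simp_all add: vec.vector_space_axioms vector_space_complex g41s_omega_eq algebra_simps)
  have "u = 0" if "\<And>v. ?\<omega> u v = 0" for u
    using that[of "g41s_basis iX0"] that[of "g41s_basis iX1"]
      that[of "g41s_basis iY1"] that[of "g41s_basis iY2"] assms
    by (simp add: g41s_omega_eq g41s_eq_iff)
  moreover have "v = 0" if "\<And>u. ?\<omega> u v = 0" for v
    using that[of "g41s_basis iX0"] that[of "g41s_basis iX1"]
      that[of "g41s_basis iY1"] that[of "g41s_basis iY2"] assms
    by (simp add: g41s_omega_eq g41s_eq_iff)
  ultimately have nd: "g41s.non_degenerate ?\<omega>"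
    unfolding g41s.non_degenerate_def by blast
  have skew: "?\<omega> X Y = - koszul_sign x y * ?\<omega> Y X" if "X \<in> g41s_V x" "Y \<in> g41s_V y" for X Y x y
    using that bit_cases[of x] bit_cases[of y]
    by (auto simp: g41s_V_even g41s_V_odd g41s_omega_eq algebra_simps)
  have cocycle: "koszul_sign x z * ?\<omega> X (g41s_br Y Z) + koszul_sign y x * ?\<omega> Y (g41s_br Z X)
      + koszul_sign z y * ?\<omega> Z (g41s_br X Y) = 0"
    if "X \<in> g41s_V x" "Y \<in> g41s_V y" "Z \<in> g41s_V z" for X Y Z x y z
    using that bit_cases[of x] bit_cases[of y] bit_cases[of z]
    by (auto simp: g41s_V_even g41s_V_odd g41s_omega_eq algebra_simps)
  have ev: "g41s.even_bilinear_form ?\<omega>"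
    using bil by (auto simp: g41s.even_bilinear_form_def g41s_V_even g41s_V_odd g41s_omega_eq)
  show ?thesis
    unfolding g41s.symplectic_structure_def using ev nd skew cocycle by blast
qed

text \<open>The cocycle identity on (X1, Y1, Y2) kills the value at (Y2, Y2), and on (X1, Y1, Y1)
  ties the value at (X0, X1) to that at (Y2, Y1). Two free values remain.\<close>

lemma g41s_symplectic_imp_omega:
  assumes \<omega>: "g41s.symplectic_structure \<omega>"
  shows "\<exists>b1 b2. b1 \<noteq> 0 \<and> \<omega> = g41s_omega b1 b2"
proof -
  note D = g41s.symplectic_structureD[OF \<omega>]
  note [simp] = bilinear_mapD[OF D(1)]
  let ?X0 = "g41s_basis iX0" and ?X1 = "g41s_basis iX1"
    and ?Y1 = "g41s_basis iY1" and ?Y2 = "g41s_basis iY2"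
  have mem [simp]: "?X0 \<in> g41s_V 0" "?X1 \<in> g41s_V 0" "?Y1 \<in> g41s_V 1" "?Y2 \<in> g41s_V 1"
    by (simp_all add: g41s_V_even g41s_V_odd)
  have br [simp]: "g41s_br ?X1 ?Y1 = - 2 *s ?Y2" "g41s_br ?Y1 ?X1 = 2 *s ?Y2"
    "g41s_br ?Y1 ?Y1 = - 2 *s ?X0" "g41s_br ?Y1 ?Y2 = 0" "g41s_br ?Y2 ?X1 = 0"
    by (simp_all add: g41s_eq_iff)
  have even: "\<omega> ?X0 ?X0 = 0" "\<omega> ?X1 ?X1 = 0" "\<omega> ?X1 ?X0 = - \<omega> ?X0 ?X1"
    using D(5)[OF mem(1,1)] D(5)[OF mem(2,2)] D(5)[OF mem(2,1)] by simp_all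
  have odd: "\<omega> ?Y1 ?Y2 = \<omega> ?Y2 ?Y1"
    using D(5)[OF mem(3,4)] by simp
  have Y22: "\<omega> ?Y2 ?Y2 = 0"
    using D(6)[OF mem(2,3,4)] by simp
  have "4 * \<omega> ?Y2 ?Y1 + 2 * \<omega> ?X0 ?X1 = 0"
    using D(6)[OF mem(2,3,3)] by (simp add: even odd)
  then have X01: "\<omega> ?X0 ?X1 = - 2 * \<omega> ?Y2 ?Y1"
    by algebra
  note mixed = D(2)[OF mem(1,3)] D(2)[OF mem(1,4)] D(2)[OF mem(2,3)] D(2)[OF mem(2,4)]
    D(3)[OF mem(1,3)] D(3)[OF mem(1,4)] D(3)[OF mem(2,3)] D(3)[OF mem(2,4)]
  have eq: "\<omega> = g41s_omega (- \<omega> ?Y2 ?Y1) (\<omega> ?Y1 ?Y1)"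
  proof (intro ext)
    fix u v
    show "\<omega> u v = g41s_omega (- \<omega> ?Y2 ?Y1) (\<omega> ?Y1 ?Y1) u v"
      by (subst (1) g41s_expansion[of u], subst (1) g41s_expansion[of v])
        (simp add: g41s_omega_eq even odd Y22 X01 mixed algebra_simps)
  qed
  \<comment> \<open>If \<open>b1\<close> were 0, X0 would be in the radical.\<close>
  have "\<omega> ?Y2 ?Y1 \<noteq> 0"
  proof
    assume "\<omega> ?Y2 ?Y1 = 0"
    then have "\<omega> ?X0 v = 0" for v
      by (subst eq) (simp add: g41s_omega_eq)
    then have "?X0 = 0"
      by (rule D(4))
    then show False
      by (simp add: g41s_eq_iff)
  qed
  then show ?thesis
    using eq by (metis neg_equal_0_iff_equal)
qed

lemma g41s_dims:
  "vec.dim (UNIV :: g41s set) = 4" "vec.dim (g41s_V 0) = 2" "vec.dim (g41s_V 1) = 2"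
proof -
  have card: "CARD(g41s_idx) = 4"
    by (simp add: UNIV_g41s_idx)
  then show "vec.dim (UNIV :: g41s set) = 4"
    by (simp add: card_cart_basis)
  have "vec.dim (vec.span {g41s_basis i, g41s_basis j}) = 2" if "i \<noteq> j" for i j
  proof -
    have "vec.independent {g41s_basis i, g41s_basis j}"
      using independent_cart_basis by (rule vec.independent_mono) (auto simp: cart_basis_def)
    moreover have "g41s_basis i \<noteq> g41s_basis j"
      using that by (simp add: axis_eq_axis)
    ultimately show ?thesis
      by (simp add: vec.dim_span_eq_card_independent del: vec.dim_span)
  qed
  then show "vec.dim (g41s_V 0) = 2" "vec.dim (g41s_V 1) = 2"
    by (simp_all add: g41s_V_def del: vec.dim_span)
qed

lemma g41s_not_abelian: "\<not> g41s.abelian"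
proof -
  have "g41s_br (g41s_basis iY1) (g41s_basis iY1) \<noteq> 0"
    by (simp add: g41s_eq_iff)
  then show ?thesis
    unfolding g41s.abelian_def by blast
qed


section \<open>Uniqueness up to i-isomorphism\<close>

context quadratic_lie_superalgebra
begin

text \<open>The coordinate map \<open>G\<close> from the model into the given algebra is explicit;
  the required isomorphism is its inverse.\<close>

lemma i_isomorphic_g41s:
  assumes "dim (V 0) = 2" "dim (V 1) = 2" "\<not> abelian" quadratic_symplectic
  shows "i_isomorphic scale V br B g41s_scale g41s_V g41s_br g41s_B"
proof -
  obtain \<omega> where "symplectic_structure \<omega>"
    using assms(4) by (auto simp: quadratic_symplectic_def)
  then obtain X0 X1 Y1 Y2 where
    mem: "X0 \<in> V 0" "X1 \<in> V 0" "Y1 \<in> V 1" "Y2 \<in> V 1" and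
    Bv: "B X0 X0 = 0" "B X0 X1 = 1" "B X1 X1 = 0" "B Y2 Y1 = 1" and
    brv: "br X0 X1 = 0" "br X0 Y1 = 0" "br X0 Y2 = 0"
      "br X1 Y1 = scale (- 2) Y2" "br X1 Y2 = 0"
      "br Y1 Y1 = scale (- 2) X0" "br Y1 Y2 = 0" "br Y2 Y2 = 0" and
    exp0: "\<And>v. v \<in> V 0 \<Longrightarrow> \<exists>k l. v = scale k X0 + scale l X1" and
    exp1: "\<And>v. v \<in> V 1 \<Longrightarrow> \<exists>k l. v = scale k Y1 + scale l Y2"
    using symplectic_frame[OF assms(1-3)] by metis
  have Bv': "B X1 X0 = 1" "B Y1 Y2 = - 1" "B Y1 Y1 = 0" "B Y2 Y2 = 0"
    using B_even_sym[OF mem(2,1)] B_odd_skew[OF mem(3,4)] B_odd_skew[OF mem(3,3)]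
      B_odd_skew[OF mem(4,4)] Bv by simp_all
  have brv': "br X1 X0 = 0" "br X0 X0 = 0" "br X1 X1 = 0" "br Y1 X0 = 0" "br Y2 X0 = 0"
    "br Y1 X1 = scale 2 Y2" "br Y2 X1 = 0" "br Y2 Y1 = 0"
    using even_skew[OF mem(2,1)] even_self[OF mem(1)] even_self[OF mem(2)]
      even_skew[OF mem(1,3)] even_skew[OF mem(1,4)] even_skew[OF mem(2,3)]
      even_skew[OF mem(2,4)] odd_sym[OF mem(4,3)] brv
    by (simp_all add: equation_minus_iff)
  note tables = mem Bv Bv' brv brv'
  define G where "G u = scale (u $ iX0) X0 + scale (u $ iX1) X1 + scale (u $ iY1) Y1 + scale (u $ iY2) Y2"
    for u :: g41s
  have G_add: "G (u + v) = G u + G v" for u v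
    by (simp add: G_def scale_left_distrib algebra_simps)
  have G_scale: "G (k *s u) = scale k (G u)" for k u
    by (simp add: G_def scale_right_distrib)
  have G_br: "G (g41s_br u v) = br (G u) (G v)" for u v
    by (simp add: G_def tables scale_left_diff_distrib scale_right_diff_distrib mult.commute mult.left_commute)
  have G_B: "B (G u) (G v) = g41s_B u v" for u v
    by (simp add: G_def tables g41s_B_eq algebra_simps)
  \<comment> \<open>Pairing with the frame recovers the coordinates of \<open>u\<close> up to sign,
    which yields injectivity of \<open>G\<close>.\<close>
  have pair: "B (G u) X1 = u $ iX0" "B (G u) X0 = u $ iX1" "B (G u) Y1 = u $ iY2"
    "B (G u) Y2 = - u $ iY1" for u
    by (simp_all add: G_def tables)
  have "inj G"
    by (rule injI) (metis pair g41s_eq_iff neg_equal_iff_equal)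
  have ev: "v \<in> G ` g41s_V 0" if "v \<in> V 0" for v
  proof -
    obtain k l where "v = scale k X0 + scale l X1"
      using exp0 \<open>v \<in> V 0\<close> by blast
    then have "v = G (k *s g41s_basis iX0 + l *s g41s_basis iX1)"
      by (simp add: G_def)
    then show ?thesis
      by (simp add: g41s_V_even)
  qed
  have od: "v \<in> G ` g41s_V 1" if "v \<in> V 1" for v
  proof -
    obtain k l where "v = scale k Y1 + scale l Y2"
      using exp1 \<open>v \<in> V 1\<close> by blast
    then have "v = G (k *s g41s_basis iY1 + l *s g41s_basis iY2)"
      by (simp add: G_def)
    then show ?thesis
      by (simp add: g41s_V_odd)
  qed
  have "v \<in> range G" for v
  proof -
    obtain v0 v1 where "v0 \<in> V 0" "v1 \<in> V 1" "v = v0 + v1"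
      using V_sum by blast
    moreover from this obtain u0 u1 where "v0 = G u0" "v1 = G u1"
      using ev od by blast
    ultimately have "v = G (u0 + u1)"
      by (simp add: G_add)
    then show ?thesis by simp
  qed
  then have "surj G" by blast
  have "G u \<in> V 0" if "u \<in> g41s_V 0" for u
    using that mem subspace_V by (simp add: G_def g41s_V_even subspace_add subspace_scale)
  moreover have "G u \<in> V 1" if "u \<in> g41s_V 1" for u
    using that mem subspace_V by (simp add: G_def g41s_V_odd subspace_add subspace_scale)
  ultimately have G_V: "G ` g41s_V d = V d" for d
    using bit_cases[of d] ev od by blast
  define A where "A = inv G"
  have AG [simp]: "A (G u) = u" for u
    using \<open>inj G\<close> by (simp add: A_def)
  have GA [simp]: "G (A v) = v" for v
    using \<open>surj G\<close> by (simp add: A_def surj_f_inv_f)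
  have "A (x + y) = A x + A y" for x y
    by (metis AG GA G_add)
  moreover have "A (scale k x) = k *s A x" for k x
    by (metis AG GA G_scale)
  ultimately have "Vector_Spaces.linear scale (*s) A"
    by (simp add: Vector_Spaces.linear_iff vector_space_axioms vec.vector_space_axioms)
  moreover have "bij A"
    by (rule o_bij[of G]) (simp_all add: fun_eq_iff)
  moreover have "A ` V d = g41s_V d" for d
    by (simp add: G_V[symmetric] image_image)
  moreover have "A (br x y) = g41s_br (A x) (A y)" for x y
    by (metis AG GA G_br)
  moreover have "g41s_B (A x) (A y) = B x y" for x y
    by (metis GA G_B)
  ultimately show ?thesis
    unfolding i_isomorphic_def lie_superalgebra_isomorphism_def by blast
qed

end

theorem proposition4p1:
  shows
    "(\<forall>(scale :: complex \<Rightarrow> 'a::ab_group_add \<Rightarrow> 'a) V br B.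
        quadratic_lie_superalgebra scale V br B \<and> \<not> lie_superalgebra.abelian br \<and>
        vector_space.dim scale UNIV = 4 \<and> vector_space.dim scale (V 1) = 0
        \<longrightarrow> \<not> quadratic_lie_superalgebra.quadratic_symplectic scale V br)
     \<and>
     (quadratic_lie_superalgebra g41s_scale g41s_V g41s_br g41s_B \<and>
      \<not> lie_superalgebra.abelian g41s_br \<and>
      vector_space.dim g41s_scale UNIV = 4 \<and>
      vector_space.dim g41s_scale (g41s_V 0) = 2 \<and> vector_space.dim g41s_scale (g41s_V 1) = 2 \<and>
      quadratic_lie_superalgebra.quadratic_symplectic g41s_scale g41s_V g41s_br)
     \<and>
     (\<forall>(scale :: complex \<Rightarrow> 'a \<Rightarrow> 'a) V br B.
        quadratic_lie_superalgebra scale V br B \<and> \<not> lie_superalgebra.abelian br \<and>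
        vector_space.dim scale UNIV = 4 \<and>
        vector_space.dim scale (V 0) = 2 \<and> vector_space.dim scale (V 1) = 2 \<and>
        quadratic_lie_superalgebra.quadratic_symplectic scale V br
        \<longrightarrow> i_isomorphic scale V br B g41s_scale g41s_V g41s_br g41s_B)
     \<and>
     (\<forall>\<omega>. lie_superalgebra.symplectic_structure g41s_scale g41s_V g41s_br \<omega> \<longleftrightarrow>
        (\<exists>b1 b2. b1 \<noteq> 0 \<and> \<omega> = g41s_omega b1 b2))"
proof (intro conjI)
  show "\<forall>(scale :: complex \<Rightarrow> 'a \<Rightarrow> 'a) V br B.
      quadratic_lie_superalgebra scale V br B \<and> \<not> lie_superalgebra.abelian br \<and>
      vector_space.dim scale UNIV = 4 \<and> vector_space.dim scale (V 1) = 0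
      \<longrightarrow> \<not> quadratic_lie_superalgebra.quadratic_symplectic scale V br"
    using quadratic_lie_superalgebra.purely_even_not_symplectic by blast
  show "quadratic_lie_superalgebra g41s_scale g41s_V g41s_br g41s_B"
    by (rule g41s.quadratic_lie_superalgebra_axioms)
  \<comment> \<open>Any nonzero \<open>b1\<close> provides a witness; here it is 1, with
    \<open>b2\<close> arbitrary.\<close>
  show "g41s.quadratic_symplectic"
    unfolding g41s.quadratic_symplectic_def using g41s_omega_symplectic[of 1] by auto
  show "\<forall>(scale :: complex \<Rightarrow> 'a \<Rightarrow> 'a) V br B.
      quadratic_lie_superalgebra scale V br B \<and> \<not> lie_superalgebra.abelian br \<and>
      vector_space.dim scale UNIV = 4 \<and>
      vector_space.dim scale (V 0) = 2 \<and> vector_space.dim scale (V 1) = 2 \<and>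
      quadratic_lie_superalgebra.quadratic_symplectic scale V br
      \<longrightarrow> i_isomorphic scale V br B g41s_scale g41s_V g41s_br g41s_B"
    using quadratic_lie_superalgebra.i_isomorphic_g41s by blast
  show "\<forall>\<omega>. g41s.symplectic_structure \<omega> \<longleftrightarrow> (\<exists>b1 b2. b1 \<noteq> 0 \<and> \<omega> = g41s_omega b1 b2)"
    using g41s_omega_symplectic g41s_symplectic_imp_omega by blast
qed (fact g41s_not_abelian g41s_dims)+

end
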